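(* Let $x=P(x)$ be a strongly connected PPS in $n$ variables in simple normal form, with LFP $q^*$ satisfying $\mathbf{0} < q^* < \mathbf{1}$. Let $x^{(0)}:=\mathbf{0}$ and $x^{(k+1)} := \mathcal{N}_P(x^{(k)})$. Then for every integer $j\ge 0$, $\| q^* - x^{(j + 2|P|)}\|_{\infty} \leq 2^{-j}$.
   Context: A PPS is a system $x_i = P_i(x)$, $i=1,\dots,n$, with each $P_i$ a polynomial with nonnegative rational coefficients (including constant term) summing to at most $1$; its LFP $q^*$ is the coordinatewise least nonnegative solution. Simple normal form: each $P_i$ is either $x_jx_k$ or linear $\sum_j p_{i,j}x_j+p_{i,0}$. The dependency graph has vertices $x_1,\dots,x_n$ and an edge $(x_i,x_j)$ iff $x_j$ occurs in some monomial of $P_i$ with positive coefficient; the PPS is strongly connected if this graph is strongly connected. $|P|$ is $n$ plus the total number of bits of all nonzero coefficients (binary numerator/denominator) and nonzero exponents. $B(x)$ is the Jacobian of $P$ and $\mathcal{N}_P(z) := z + (I-B(z))^{-1}(P(z)-z)$. *)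

theory Defs
  imports
    "HOL-Analysis.Analysis"
    "HOL-Library.Poly_Mapping"
    "HOL-Library.Log_Nat"
    "Graph_Theory.Digraph_Component"
begin

text \<open>
  The variables of a system in n variables are indexed by a finite type \<open>'n\<close> with n elements.
  A monomial is a finitely supported exponent map and a polynomial a finitely supported
  map from monomials to coefficients, with the convolution product of Poly\_Mapping.
\<close>

type_synonym 'n monomial = "'n \<Rightarrow>\<^sub>0 nat"
type_synonym 'n polynomial = "'n monomial \<Rightarrow>\<^sub>0 rat"
type_synonym 'n system = "'n \<Rightarrow> 'n polynomial"

definition Const :: "rat \<Rightarrow> 'n polynomial" where
  "Const c = Poly_Mapping.single 0 c"

definition Var :: "'n \<Rightarrow> 'n polynomial" where
  "Var j = Poly_Mapping.single (Poly_Mapping.single j 1) 1"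

definition poly_eval :: "'n::finite polynomial \<Rightarrow> real ^ 'n \<Rightarrow> real" where
  "poly_eval p x =
    (\<Sum>m \<in> Poly_Mapping.keys p. of_rat (Poly_Mapping.lookup p m) *
      (\<Prod>j \<in> UNIV. (x $ j) ^ Poly_Mapping.lookup m j))"

definition system_eval :: "'n::finite system \<Rightarrow> real ^ 'n \<Rightarrow> real ^ 'n" where
  "system_eval P x = (\<chi> i. poly_eval (P i) x)"

definition is_pps :: "'n system \<Rightarrow> bool" where
  "is_pps P \<longleftrightarrow>
    (\<forall>i. (\<forall>m. 0 \<le> Poly_Mapping.lookup (P i) m) \<and>
         (\<Sum>m \<in> Poly_Mapping.keys (P i). Poly_Mapping.lookup (P i) m) \<le> 1)"

definition simple_normal_form :: "'n::finite system \<Rightarrow> bool" where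
  "simple_normal_form P \<longleftrightarrow>
    (\<forall>i. (\<exists>j k. P i = Var j * Var k) \<or>
         (\<exists>a a0. P i = (\<Sum>j \<in> UNIV. Const (a j) * Var j) + Const a0))"

definition is_lfp :: "'n::finite system \<Rightarrow> real ^ 'n \<Rightarrow> bool" where
  "is_lfp P q \<longleftrightarrow>
    (\<forall>i. 0 \<le> q $ i) \<and> system_eval P q = q \<and>
    (\<forall>x. (\<forall>i. 0 \<le> x $ i) \<and> system_eval P x = x \<longrightarrow> (\<forall>i. q $ i \<le> x $ i))"

definition dependency_graph :: "'n system \<Rightarrow> 'n pair_pre_digraph" where
  "dependency_graph P =
    \<lparr> pverts = UNIV,
      parcs = {(i, j). \<exists>m. 0 < Poly_Mapping.lookup (P i) m \<and> 0 < Poly_Mapping.lookup m j} \<rparr>"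

text \<open>
  \<open>quotient_of\<close> yields the reduced fraction with positive denominator, and \<open>bitlen\<close> is the
  number of binary digits of a positive integer.
\<close>

definition rat_bits :: "rat \<Rightarrow> nat" where
  "rat_bits c = (case quotient_of c of (a, b) \<Rightarrow> nat (bitlen \<bar>a\<bar>) + nat (bitlen b))"

definition encoding_size :: "'n::finite system \<Rightarrow> nat" where
  "encoding_size P =
    CARD('n) +
    (\<Sum>i \<in> UNIV. \<Sum>m \<in> Poly_Mapping.keys (P i).
       rat_bits (Poly_Mapping.lookup (P i) m) +
       (\<Sum>j \<in> Poly_Mapping.keys m. nat (bitlen (int (Poly_Mapping.lookup m j)))))"

definition B :: "'n::finite system \<Rightarrow> real ^ 'n \<Rightarrow> real ^ 'n ^ 'n" where
  "B P x = jacobian (system_eval P) (at x)"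

text \<open>
  \<open>matrix_inv\<close> is total, with an unspecified value at singular matrices, so the Newton step is
  meaningful at \<open>z\<close> only if \<open>mat 1 - B P z\<close> is invertible.
\<close>

definition newton_step :: "'n::finite system \<Rightarrow> real ^ 'n \<Rightarrow> real ^ 'n" where
  "newton_step P z = z + matrix_inv (mat 1 - B P z) *v (system_eval P z - z)"

definition newton_iterate :: "'n::finite system \<Rightarrow> nat \<Rightarrow> real ^ 'n" where
  "newton_iterate P k = (newton_step P ^^ k) 0"

end

theory Submission
  imports Defs
begin

text \<open>
  Write \<open>u = 1 - q\<close>. Expanding \<open>P\<close> around \<open>q\<close> gives \<open>B(q) u \<le> u\<close>, and the Newton error satisfies
  \<open>(I - B(z)) (q - N(z)) = R(q - z)\<close>, where \<open>R\<close> is the purely quadratic part of \<open>P\<close>.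
  If \<open>0 \<le> q - z \<le> r u\<close> then \<open>R(q - z) \<le> (r/2) (B(q) - B(z)) u \<le> (r/2) (I - B(z)) u\<close>, so, as
  \<open>(I - B(z))\<^sup>-\<^sup>1 \<ge> 0\<close>, each step halves \<open>r\<close>. Along an edge \<open>(i, l)\<close> of the dependency
  graph \<open>u\<^sub>l \<le> 2^b u\<^sub>i\<close>, with \<open>b\<close> the bit size of the coefficients of \<open>P\<^sub>i\<close>; by strong connectivity all
  entries of \<open>u\<close> are within a factor \<open>2^|P|\<close> of each other, which controls the initial \<open>r\<close>.
\<close>

section \<open>Evaluation and coefficients of polynomials\<close>

lemma poly_eval_superset:
  assumes "finite A" and "Poly_Mapping.keys p \<subseteq> A"
  shows "poly_eval p x = (\<Sum>m\<in>A. of_rat (Poly_Mapping.lookup p m) *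
    (\<Prod>j\<in>UNIV. (x $ j) ^ Poly_Mapping.lookup m j))"
  unfolding poly_eval_def using assms
  by (intro sum.mono_neutral_left) (auto simp: in_keys_iff)

lemma poly_eval_zero: "poly_eval 0 x = 0"
  by (simp add: poly_eval_def)

lemma poly_eval_add: "poly_eval (p + r) x = poly_eval p x + poly_eval r x"
proof -
  let ?A = "Poly_Mapping.keys p \<union> Poly_Mapping.keys r"
  have "finite ?A" by simp
  moreover have "Poly_Mapping.keys (p + r) \<subseteq> ?A" by (rule Poly_Mapping.keys_add)
  ultimately show ?thesis
    by (simp add: poly_eval_superset[of ?A] lookup_add of_rat_add distrib_right sum.distrib)
qed

lemma poly_eval_sum: "poly_eval (\<Sum>i\<in>I. p i) x = (\<Sum>i\<in>I. poly_eval (p i) x)"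
  by (induction I rule: infinite_finite_induct) (simp_all add: poly_eval_zero poly_eval_add)

lemma poly_eval_single:
  "poly_eval (Poly_Mapping.single m c) x =
    of_rat c * (\<Prod>j\<in>UNIV. (x $ j) ^ Poly_Mapping.lookup m j)"
  by (subst poly_eval_superset[of "{m}"]) auto

lemma prod_power_single:
  fixes x :: "real ^ 'n::finite"
  shows "(\<Prod>i\<in>UNIV. (x $ i) ^ Poly_Mapping.lookup (Poly_Mapping.single j 1) i) = x $ j"
proof -
  have "(\<Prod>i\<in>UNIV. (x $ i) ^ Poly_Mapping.lookup (Poly_Mapping.single j 1) i) =
      (\<Prod>i\<in>UNIV. if j = i then x $ i else 1)"
    by (intro prod.cong) (auto simp: lookup_single when_def)
  then show ?thesis by simp
qed

lemma Var_mult: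
  "Var j * Var k = Poly_Mapping.single (Poly_Mapping.single j 1 + Poly_Mapping.single k 1) 1"
  by (simp add: Var_def mult_single)

lemma Const_mult_Var: "Const c * Var j = Poly_Mapping.single (Poly_Mapping.single j 1) c"
  by (simp add: Var_def Const_def mult_single)

lemma poly_eval_Var_mult: "poly_eval (Var j * Var k) x = x $ j * x $ k"
  unfolding Var_mult poly_eval_single
  by (simp add: lookup_add power_add prod.distrib prod_power_single[unfolded One_nat_def])

lemma poly_eval_linear:
  "poly_eval ((\<Sum>j\<in>UNIV. Const (a j) * Var j) + Const c) x = (\<Sum>j\<in>UNIV. of_rat (a j) * x $ j) + of_rat c"
  unfolding poly_eval_add poly_eval_sum Const_mult_Var
  unfolding Const_def poly_eval_single
  by (simp add: prod_power_single[unfolded One_nat_def])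

lemma single_one_eq_iff: "Poly_Mapping.single j (1::nat) = Poly_Mapping.single k 1 \<longleftrightarrow> j = k"
  by (metis lookup_single_eq lookup_single_not_eq zero_neq_one)

lemma single_one_neq_zero: "Poly_Mapping.single j (1::nat) \<noteq> 0"
  by (metis lookup_single_eq lookup_zero zero_neq_one)

lemma lookup_linear:
  "Poly_Mapping.lookup ((\<Sum>j\<in>UNIV. Const (a j) * Var j) + Const c) m =
    (\<Sum>j\<in>UNIV. a j when Poly_Mapping.single j 1 = m) + (c when m = 0)"
  unfolding Const_mult_Var
  unfolding Const_def
  by (simp add: lookup_add lookup_sum lookup_single eq_commute[of 0])

lemma lookup_linear_single:
  fixes a :: "'n::finite \<Rightarrow> rat"
  shows "Poly_Mapping.lookup ((\<Sum>j\<in>UNIV. Const (a j) * Var j) + Const c) (Poly_Mapping.single k 1) = a k"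
  using single_one_eq_iff[where 'a='n] single_one_neq_zero[where 'a='n]
  by (simp add: lookup_linear when_def)

lemma lookup_linear_zero:
  fixes a :: "'n::finite \<Rightarrow> rat"
  shows "Poly_Mapping.lookup ((\<Sum>j\<in>UNIV. Const (a j) * Var j) + Const c) 0 = c"
  using single_one_neq_zero[where 'a='n] by (simp add: lookup_linear when_def)

text \<open>Identifies the monomial behind an edge leaving a linear row, so that the coefficient on
  this edge is \<open>a j\<close>.\<close>

lemma lookup_linear_pos_single:
  fixes a :: "'n::finite \<Rightarrow> rat"
  assumes "Poly_Mapping.lookup ((\<Sum>j\<in>UNIV. Const (a j) * Var j) + Const c) m \<noteq> 0"
    and "0 < Poly_Mapping.lookup m j"
  shows "m = Poly_Mapping.single j 1"
proof -
  have "m \<noteq> 0" using assms(2) by auto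
  with assms(1) have "(\<Sum>j\<in>UNIV. a j when Poly_Mapping.single j 1 = m) \<noteq> 0"
    by (simp add: lookup_linear when_def)
  then obtain k where "m = Poly_Mapping.single k 1"
    by (metis (mono_tags, lifting) sum.neutral when_def)
  with assms(2) show ?thesis
    by (metis lookup_single_not_eq less_irrefl)
qed

section \<open>Coefficient sizes and closed sets in the dependency graph\<close>

text \<open>A positive fraction \<open>a / b\<close> has an integer numerator
  \<open>a \<ge> 1\<close>, so it is at least \<open>1 / b\<close>, and \<open>b\<close> lies below
  two to the power of its bit length.\<close>

lemma rat_bits_bound:
  assumes "0 < c"
  shows "1 \<le> 2 ^ rat_bits c * (of_rat c :: real)"
proof -
  obtain a b where ab: "quotient_of c = (a, b)" by fastforce
  have b: "0 < b" using quotient_of_denom_pos[OF ab] .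
  have c: "c = of_int a / of_int b" using quotient_of_div[OF ab] .
  then have a: "1 \<le> a" using assms b by (simp add: zero_less_divide_iff)
  have "b < 2 ^ nat (bitlen b)" using bitlen_bounds[OF b] by simp
  then have "real_of_int b < 2 ^ nat (bitlen b)"
    by (metis of_int_less_iff of_int_numeral of_int_power)
  also have "\<dots> \<le> 2 ^ rat_bits c" by (simp add: rat_bits_def ab)
  finally have "real_of_int b * 1 \<le> 2 ^ rat_bits c * real_of_int a"
    using a b by (intro mult_mono) auto
  then show ?thesis using b by (simp add: c of_rat_divide field_simps)
qed

text \<open>Membership spreads along a path from \<open>i\<close> to any vertex. Applied below to a
  set of minimisers and to the complement of a set of good indices.\<close>

lemma strongly_connected_closed_UNIV:
  fixes P :: "'n system"
  assumes "strongly_connected (with_proj (dependency_graph P))"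
    and "i \<in> S"
    and closed: "\<And>i j m. i \<in> S \<Longrightarrow> 0 < Poly_Mapping.lookup (P i) m \<Longrightarrow> 0 < Poly_Mapping.lookup m j \<Longrightarrow> j \<in> S"
  shows "S = UNIV"
proof -
  let ?G = "with_proj (dependency_graph P)"
  have "j \<in> S" for j
  proof -
    have "i \<rightarrow>\<^sup>*\<^bsub>?G\<^esub> j"
      using assms(1) by (auto simp: strongly_connected_def dependency_graph_def)
    then have "(i, j) \<in> (arcs_ends ?G)\<^sup>*" by (rule reachable_rtranclI)
    then show ?thesis
    proof induction
      case base
      show ?case by (rule assms(2))
    next
      case (step k l)
      then show ?case
        using closed by (auto simp: arcs_ends_conv dependency_graph_def)
    qed
  qed
  then show ?thesis by auto
qed

text \<open>Splitting the encoding size by rows makes it possible to charge each row separately when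
  estimates are chained along edges.\<close>

definition coeff_bits :: "'n system \<Rightarrow> 'n \<Rightarrow> nat" where
  "coeff_bits P i = (\<Sum>m\<in>Poly_Mapping.keys (P i). rat_bits (Poly_Mapping.lookup (P i) m))"

lemma sum_coeff_bits_le: "(\<Sum>i\<in>UNIV. coeff_bits P i) \<le> encoding_size P"
  unfolding coeff_bits_def encoding_size_def
  by (rule trans_le_add2, rule sum_mono, rule sum_mono) simp

lemma coeff_bits_bound:
  assumes "0 < Poly_Mapping.lookup (P i) m"
  shows "1 \<le> 2 ^ coeff_bits P i * (of_rat (Poly_Mapping.lookup (P i) m) :: real)"
proof -
  have "rat_bits (Poly_Mapping.lookup (P i) m) \<le> coeff_bits P i"
    unfolding coeff_bits_def using assms
    by (intro member_le_sum) (auto simp: in_keys_iff)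
  then have "(2::real) ^ rat_bits (Poly_Mapping.lookup (P i) m) \<le> 2 ^ coeff_bits P i" by simp
  moreover have "0 \<le> (of_rat (Poly_Mapping.lookup (P i) m) :: real)" using assms by simp
  ultimately show ?thesis
    using rat_bits_bound[OF assms] mult_right_mono order_trans by blast
qed

section \<open>Rows in simple normal form and the Newton equation\<close>

lemma poly_eval_1: "poly_eval p 1 = of_rat (\<Sum>m\<in>Poly_Mapping.keys p. Poly_Mapping.lookup p m)"
  by (simp add: poly_eval_def of_rat_sum)

text \<open>Translates the two syntactic row shapes into facts about values and outgoing edges, so
  that later arguments need not inspect polynomials.\<close>

lemma pps_row_cases:
  fixes P :: "'n::finite system"
  assumes "is_pps P" and "simple_normal_form P"
  obtains
    (quadratic) j k where "\<And>x. system_eval P x $ i = x $ j * x $ k"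
      and "\<And>m l. 0 < Poly_Mapping.lookup (P i) m \<Longrightarrow> 0 < Poly_Mapping.lookup m l \<Longrightarrow> l = j \<or> l = k"
  | (linear) a c where "\<And>x. system_eval P x $ i = (\<Sum>j\<in>UNIV. a j * x $ j) + c"
      and "\<And>j. 0 \<le> a j" and "0 \<le> c" and "(\<Sum>j\<in>UNIV. a j) + c \<le> 1"
      and "\<And>m l. 0 < Poly_Mapping.lookup (P i) m \<Longrightarrow> 0 < Poly_Mapping.lookup m l \<Longrightarrow>
        0 < a l \<and> 1 \<le> 2 ^ coeff_bits P i * a l"
proof -
  consider (q) j k where "P i = Var j * Var k"
    | (l) b d where "P i = (\<Sum>j \<in> UNIV. Const (b j) * Var j) + Const d"
    using assms(2) unfolding simple_normal_form_def by metis
  then show thesis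
  proof cases
    case q
    show thesis
    proof (rule quadratic)
      show "system_eval P x $ i = x $ j * x $ k" for x
        by (simp add: system_eval_def q poly_eval_Var_mult)
      show "l = j \<or> l = k" if "0 < Poly_Mapping.lookup (P i) m" and "0 < Poly_Mapping.lookup m l" for m l
        using that unfolding q Var_mult by (auto simp: lookup_single lookup_add when_def split: if_splits)
    qed
  next
    case l
    have nn: "0 \<le> Poly_Mapping.lookup (P i) m" for m using assms(1) by (simp add: is_pps_def)
    have eval: "system_eval P x $ i = (\<Sum>j\<in>UNIV. of_rat (b j) * x $ j) + of_rat d" for x
      by (simp add: system_eval_def l poly_eval_linear)
    show thesis
    proof (rule linear)
      show "system_eval P x $ i = (\<Sum>j\<in>UNIV. of_rat (b j) * x $ j) + of_rat d" for x
        by (rule eval)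
      show "0 \<le> (of_rat (b j) :: real)" for j
        using nn[of "Poly_Mapping.single j 1"] unfolding l lookup_linear_single by simp
      show "0 \<le> (of_rat d :: real)"
        using nn[of 0] unfolding l lookup_linear_zero by simp
      \<comment> \<open>At the all-ones vector the value of the row is its coefficient sum, which
        \<open>eval\<close> rewrites in terms of \<open>b\<close> and \<open>d\<close>.\<close>
      have "poly_eval (P i) 1 \<le> 1"
        using assms(1) unfolding is_pps_def poly_eval_1 by simp
      then show "(\<Sum>j\<in>UNIV. of_rat (b j)) + of_rat d \<le> (1::real)"
        using eval[of 1] by (simp add: system_eval_def)
      show "0 < (of_rat (b k) :: real) \<and> 1 \<le> 2 ^ coeff_bits P i * (of_rat (b k) :: real)"
        if "0 < Poly_Mapping.lookup (P i) m" and "0 < Poly_Mapping.lookup m k" for m k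
      proof -
        have "m = Poly_Mapping.single k 1"
          using that lookup_linear_pos_single[of b d m k] unfolding l by linarith
        then have "Poly_Mapping.lookup (P i) m = b k" 
          unfolding l by (simp only: lookup_linear_single)
        then show ?thesis using that(1) coeff_bits_bound[of P i m] by simp
      qed
    qed
  qed
qed


text \<open>Multiplying the Newton step by \<open>I - B(z)\<close> leaves a linear equation for the
  increment; the later estimates use this equation instead of the inverse.\<close>

lemma newton_step_eq:
  assumes "invertible (mat 1 - B P z)"
  shows "newton_step P z - z - B P z *v (newton_step P z - z) = system_eval P z - z"
proof -
  let ?A = "mat 1 - B P z"
  \<comment> \<open>\<open>matrix_inv\<close> is a choice operator; invertibility guarantees that
    the chosen matrix really is an inverse.\<close>
  have "?A ** matrix_inv ?A = mat 1"
    using assms unfolding invertible_def matrix_inv_def by (rule someI2_ex) blast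
  then have "?A *v (newton_step P z - z) = system_eval P z - z"
    by (simp add: newton_step_def matrix_vector_mul_assoc)
  then show ?thesis by (simp add: matrix_vector_mult_diff_rdistrib)
qed

section \<open>The Jacobian of the system, row by row\<close>

locale snf_pps =
  fixes P :: "'n::finite system" and q :: "real ^ 'n"
  assumes pps: "is_pps P"
    and snf: "simple_normal_form P"
    and sc: "strongly_connected (with_proj (dependency_graph P))"
    and lfp: "is_lfp P q"
    and q_pos: "\<And>i. 0 < q $ i" and q_less_1: "\<And>i. q $ i < 1"
begin

lemma differentiable_row: "(\<lambda>x. system_eval P x $ i) differentiable at x"
  by (cases rule: pps_row_cases[OF pps snf, of i]) (simp_all add: bounded_linear_imp_differentiable bounded_linear_vec_nth)

lemma differentiable_system_eval: "system_eval P differentiable at x"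
  unfolding differentiable_componentwise_within[of "system_eval P"]
  using differentiable_row by (auto simp: Basis_vec_def inner_axis)

lemma has_derivative_row:
  "((\<lambda>x. system_eval P x $ i) has_derivative (\<lambda>d. (B P x *v d) $ i)) (at x)"
proof -
  have "(system_eval P has_derivative (\<lambda>d. B P x *v d)) (at x)"
    using differentiable_system_eval jacobian_works unfolding B_def by blast
  then show ?thesis by (rule bounded_linear.has_derivative[OF bounded_linear_vec_nth])
qed

text \<open>Each row is differentiated directly; uniqueness of derivatives identifies the result
  with the corresponding row of \<open>B\<close>.\<close>

lemma row_cases:
  obtains
    (quadratic) j k where "\<And>x. system_eval P x $ i = x $ j * x $ k"
      and "\<And>x d. (B P x *v d) $ i = x $ j * d $ k + d $ j * x $ k"
      and "\<And>m l. 0 < Poly_Mapping.lookup (P i) m \<Longrightarrow> 0 < Poly_Mapping.lookup m l \<Longrightarrow> l = j \<or> l = k"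
  | (linear) a c where "\<And>x. system_eval P x $ i = (\<Sum>j\<in>UNIV. a j * x $ j) + c"
      and "\<And>x d. (B P x *v d) $ i = (\<Sum>j\<in>UNIV. a j * d $ j)"
      and "\<And>j. 0 \<le> a j" and "0 \<le> c" and "(\<Sum>j\<in>UNIV. a j) + c \<le> 1"
      and "\<And>m l. 0 < Poly_Mapping.lookup (P i) m \<Longrightarrow> 0 < Poly_Mapping.lookup m l \<Longrightarrow>
        0 < a l \<and> 1 \<le> 2 ^ coeff_bits P i * a l"
proof -
  have nth: "((\<lambda>x. x $ j) has_derivative (\<lambda>d. d $ j)) (at x)" for j and x :: "real ^ 'n"
    by (simp add: bounded_linear_imp_has_derivative bounded_linear_vec_nth)
  show thesis
  proof (cases rule: pps_row_cases[OF pps snf, of i, case_names q l])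
    case (q j k)
    have "((\<lambda>x. system_eval P x $ i) has_derivative (\<lambda>d. x $ j * d $ k + d $ j * x $ k)) (at x)" for x
      unfolding q(1) by (intro has_derivative_mult nth)
    from fun_cong[OF has_derivative_unique[OF has_derivative_row this]]
    have "(B P x *v d) $ i = x $ j * d $ k + d $ j * x $ k" for x d .
    with q show thesis by (intro quadratic) auto
  next
    case (l a c)
    have "((\<lambda>x. system_eval P x $ i) has_derivative (\<lambda>d. \<Sum>j\<in>UNIV. a j * d $ j)) (at x)" for x
      unfolding l(1) by (intro has_derivative_add_const has_derivative_sum has_derivative_mult_right nth)
    from fun_cong[OF has_derivative_unique[OF has_derivative_row this]]
    have "(B P x *v d) $ i = (\<Sum>j\<in>UNIV. a j * d $ j)" for x d .
    with l show thesis by (intro linear) auto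
  qed
qed

lemma fixed_point: "system_eval P q = q"
  using lfp by (simp add: is_lfp_def)

section \<open>Nonnegativity of the inverse of I - B(z)\<close>

text \<open>With \<open>u = 1 - q\<close>, the slack is \<open>u_j * u_k\<close> in a quadratic row
  and one minus the coefficient sum in a linear row.\<close>

lemma B_q_complement_le: "(B P q *v (1 - q)) $ i \<le> (1 - q) $ i"
proof (cases rule: row_cases[of i, case_names quad lin])
  case (quad j k)
  have "q $ i = q $ j * q $ k" using quad(1)[of q] fixed_point by simp
  moreover have "0 < (1 - q $ j) * (1 - q $ k)"
    using q_less_1 by simp
  ultimately show ?thesis by (simp add: quad(1,2) algebra_simps)
next
  case (lin a c)
  have "q $ i = (\<Sum>j\<in>UNIV. a j * q $ j) + c" using lin(1)[of q] fixed_point by simp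
  with lin(5) show ?thesis by (simp add: lin(2) algebra_simps sum_subtractf)
qed

text \<open>
  If the minimum \<open>m\<close> of \<open>y\<^sub>i / u\<^sub>i\<close> were negative, the set of minimisers would be closed under
  dependency, hence everything, and would contain only linear rows with \<open>(B u)\<^sub>i = u\<^sub>i\<close>; then
  \<open>q - t u\<close> would be a smaller fixed point for small \<open>t > 0\<close>.
\<close>

lemma B_nonneg_solution:
  assumes z: "\<And>i. 0 \<le> z $ i" "\<And>i. z $ i \<le> q $ i"
    and y: "\<And>i. (B P z *v y) $ i \<le> y $ i"
  shows "0 \<le> y $ i"
proof -
  define u where "u = 1 - q"
  have u: "0 < u $ i" for i using q_less_1 by (simp add: u_def)
  define m where "m = Min (range (\<lambda>i. y $ i / u $ i))"
  have m_le: "m * u $ i \<le> y $ i" for i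
  proof -
    have "m \<le> y $ i / u $ i" unfolding m_def by (intro Min_le) auto
    then show ?thesis using u by (simp add: pos_le_divide_eq)
  qed
  have "m \<in> range (\<lambda>i. y $ i / u $ i)" unfolding m_def by (intro Min_in) auto
  then obtain i0 where "m = y $ i0 / u $ i0" by auto
  then have i0: "m * u $ i0 = y $ i0" using u[of i0] by simp
  have "0 \<le> m"
  proof (rule ccontr)
    assume "\<not> 0 \<le> m"
    then have m: "m < 0" by simp
    define S where "S = {i. y $ i = m * u $ i}"
    have key: "(\<forall>p j. 0 < Poly_Mapping.lookup (P i) p \<longrightarrow> 0 < Poly_Mapping.lookup p j \<longrightarrow> j \<in> S) \<and>
        (\<forall>t. system_eval P (q - t *\<^sub>R u) $ i = q $ i - t * u $ i)"
      if "i \<in> S" for i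
    proof (cases rule: row_cases[of i, case_names quad lin])
      case (quad j k)
      have qi: "q $ i = q $ j * q $ k" using quad(1)[of q] fixed_point by simp
      have "0 < (1 - q $ j) * (1 - q $ k)" using q_less_1 by simp
      then have strict: "q $ j * u $ k + u $ j * q $ k < u $ i" by (simp add: u_def qi algebra_simps)
      have "z $ j * u $ k + u $ j * z $ k \<le> q $ j * u $ k + u $ j * q $ k"
        using z u q_pos by (intro add_mono mult_left_mono mult_right_mono) (auto simp: less_imp_le)
      \<comment> \<open>Multiplying by the negative \<open>m\<close> reverses the inequality. The
        chain ends in \<open>m * u $ i < y $ i\<close>, which is impossible for a minimiser, so
        \<open>S\<close> contains no quadratic row.\<close>
      with strict have "m * u $ i < m * (z $ j * u $ k + u $ j * z $ k)"
        using m by (intro mult_strict_left_mono_neg) auto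
      also have "\<dots> = z $ j * (m * u $ k) + (m * u $ j) * z $ k" by (simp add: algebra_simps)
      also have "\<dots> \<le> z $ j * y $ k + y $ j * z $ k"
        using m_le z by (intro add_mono mult_mono' mult_left_mono mult_right_mono) auto
      also have "\<dots> \<le> y $ i" using y[of i] by (simp add: quad(1,2))
      finally show ?thesis using that by (simp add: S_def)
    next
      case (lin a c)
      have qi: "q $ i = (\<Sum>j\<in>UNIV. a j * q $ j) + c" using lin(1)[of q] fixed_point by simp
      have au: "(\<Sum>j\<in>UNIV. a j * u $ j) \<le> u $ i"
        using B_q_complement_le[of i] by (simp add: lin(2) u_def)
      have le: "a j * (m * u $ j) \<le> a j * y $ j" for j
        using m_le lin(3) by (intro mult_left_mono) auto
      have "m * u $ i \<le> m * (\<Sum>j\<in>UNIV. a j * u $ j)"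
        using au m by (intro mult_left_mono_neg) auto
      also have "\<dots> = (\<Sum>j\<in>UNIV. a j * (m * u $ j))" by (simp add: sum_distrib_left algebra_simps)
      finally have 1: "m * u $ i \<le> (\<Sum>j\<in>UNIV. a j * (m * u $ j))" .
      have 2: "(\<Sum>j\<in>UNIV. a j * (m * u $ j)) \<le> (\<Sum>j\<in>UNIV. a j * y $ j)"
        using le by (intro sum_mono)
      have 3: "(\<Sum>j\<in>UNIV. a j * y $ j) \<le> m * u $ i" using y[of i] that by (simp add: lin(2) S_def)
      \<comment> \<open>The chain starts and ends at \<open>m * u $ i\<close>, so every inequality
        is tight. Tightness of the sums passes to each term, so successors with positive coefficient
        are minimisers too.\<close>
      from 1 2 3 have sum_eq: "(\<Sum>j\<in>UNIV. a j * (m * u $ j)) = (\<Sum>j\<in>UNIV. a j * y $ j)"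
        and "m * u $ i = (\<Sum>j\<in>UNIV. a j * (m * u $ j))" by linarith+
      then have "m * u $ i = m * (\<Sum>j\<in>UNIV. a j * u $ j)" by (simp add: sum_distrib_left algebra_simps)
      then have au: "(\<Sum>j\<in>UNIV. a j * u $ j) = u $ i" using m by simp
      have "a j * (m * u $ j) = a j * y $ j" for j
        using sum_mono_inv[OF sum_eq le] by auto
      then have "j \<in> S" if "0 < a j" for j using that by (simp add: S_def) (metis less_irrefl)
      moreover have "system_eval P (q - t *\<^sub>R u) $ i = q $ i - t * u $ i" for t
        by (simp add: lin(1) qi au[symmetric] right_diff_distrib sum_subtractf sum_distrib_left mult.left_commute)
      ultimately show ?thesis using lin(6) by blast
    qed
    have "i0 \<in> S" using i0 by (simp add: S_def)
    then have S: "S = UNIV" by (rule strongly_connected_closed_UNIV[OF sc]) (use key in blast)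
    \<comment> \<open>Since \<open>u \<le> 1\<close>, subtracting \<open>t * u\<close> with
      \<open>t\<close> the smallest entry of \<open>q\<close> keeps the point nonnegative.\<close>
    define t where "t = Min (range (\<lambda>i. q $ i))"
    have t: "t \<le> q $ i" for i unfolding t_def by (intro Min_le) auto
    have "t \<in> range (\<lambda>i. q $ i)" unfolding t_def by (intro Min_in) auto
    then have t_pos: "0 < t" using q_pos by auto
    have "system_eval P (q - t *\<^sub>R u) = q - t *\<^sub>R u"
      using key S by (simp add: vec_eq_iff)
    moreover have "0 \<le> (q - t *\<^sub>R u) $ i" for i
    proof -
      have "t * u $ i \<le> t * 1" using t_pos q_pos[of i] by (intro mult_left_mono) (auto simp: u_def)
      with t[of i] show ?thesis by simp
    qed
    ultimately have "q $ i0 \<le> (q - t *\<^sub>R u) $ i0" 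
      using lfp[unfolded is_lfp_def, THEN conjunct2, THEN conjunct2, rule_format, of "q - t *\<^sub>R u"]
      by blast
    then show False using t_pos u[of i0] by (simp add: mult_le_0_iff)
  qed
  then have "0 \<le> m * u $ i" using u[of i] by simp
  with m_le[of i] show ?thesis by linarith
qed

text \<open>If \<open>y\<close> is in the kernel, both \<open>y\<close> and \<open>- y\<close>
  satisfy the hypothesis of \<open>B_nonneg_solution\<close>, so both are nonnegative and
  \<open>y\<close> vanishes.\<close>

lemma invertible_newton_matrix:
  assumes "\<And>i. 0 \<le> z $ i" "\<And>i. z $ i \<le> q $ i"
  shows "invertible (mat 1 - B P z)"
proof -
  have "y = 0" if "(mat 1 - B P z) *v y = 0" for y
  proof -
    have y: "B P z *v y = y" using that by (simp add: matrix_vector_mult_diff_rdistrib)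
    then have "B P z *v (- y) = - y"
      using matrix_vector_mult_diff_distrib[of "B P z" 0 y] by simp
    then have "0 \<le> (- y) $ i" for i using B_nonneg_solution[OF assms, of "- y"] by simp
    moreover have "0 \<le> y $ i" for i using B_nonneg_solution[OF assms, of y] y by simp
    ultimately show ?thesis by (auto simp: vec_eq_iff intro!: antisym)
  qed
  then show ?thesis unfolding invertible_left_inverse matrix_left_invertible_ker by blast
qed

section \<open>Monotonicity of the Newton steps and halving of the error\<close>

text \<open>With \<open>N\<close> the new point, three of the bounds apply
  \<open>B_nonneg_solution\<close> to the increment \<open>d\<close>, the error \<open>q - N\<close>
  and the difference \<open>(r/2) u - (q - N)\<close>. The remaining one holds because
  \<open>P(N) - N\<close> is the quadratic part of \<open>P\<close> at \<open>d\<close>.\<close>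

lemma newton_step_bounds:
  assumes z: "\<And>i. 0 \<le> z $ i" "\<And>i. z $ i \<le> q $ i" "\<And>i. z $ i \<le> system_eval P z $ i"
    and lam: "\<And>i. q $ i - z $ i \<le> r * (1 - q $ i)"
  shows "z $ i \<le> newton_step P z $ i"
    and "newton_step P z $ i \<le> q $ i"
    and "newton_step P z $ i \<le> system_eval P (newton_step P z) $ i"
    and "q $ i - newton_step P z $ i \<le> r / 2 * (1 - q $ i)"
proof -
  define N where "N = newton_step P z"
  define d where "d = N - z"
  define e where "e = q - z"
  define u where "u = 1 - q"
  have u: "0 < u $ i" for i using q_less_1 by (simp add: u_def)
  have e: "0 \<le> e $ i" "e $ i \<le> r * u $ i" for i using z lam by (simp_all add: e_def u_def)
  \<comment> \<open>\<open>undefined\<close> is merely some index: a single component already forces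
    \<open>r\<close> to be nonnegative.\<close>
  have "0 \<le> r * u $ undefined" using e order_trans by blast
  then have r: "0 \<le> r" using u[of undefined] by (simp add: zero_le_mult_iff)
  have d: "d $ i - (B P z *v d) $ i = system_eval P z $ i - z $ i" for i
    using newton_step_eq[OF invertible_newton_matrix[OF z(1,2)]]
    by (simp add: d_def N_def vec_eq_iff)
  have d_nonneg: "0 \<le> d $ i" for i
  proof (rule B_nonneg_solution[OF z(1,2)])
    show "(B P z *v d) $ i \<le> d $ i" for i using d[of i] z(3)[of i] by simp
  qed
  then show "z $ i \<le> newton_step P z $ i" by (simp add: d_def N_def)
  have N: "N = z + d" by (simp add: d_def)
  have "N $ i \<le> system_eval P N $ i" for i
  proof (cases rule: row_cases[of i, case_names quad lin])
    case (quad j k)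
    have "0 \<le> d $ j * d $ k" using d_nonneg by simp
    with d[of i] show ?thesis by (simp add: quad(1,2) N algebra_simps)
  next
    case (lin a c)
    from d[of i] show ?thesis by (simp add: lin(1,2) N algebra_simps sum.distrib)
  qed
  then show "newton_step P z $ i \<le> system_eval P (newton_step P z) $ i" by (simp add: N_def)
  have qN: "q - N = e - d" by (simp add: e_def d_def)
  have rem: "0 \<le> (q - N) $ i - (B P z *v (q - N)) $ i \<and>
    (q - N) $ i - (B P z *v (q - N)) $ i \<le> r / 2 * (u $ i - (B P z *v u) $ i)" for i
  proof -
    have B: "(B P z *v (q - N)) $ i = (B P z *v e) $ i - (B P z *v d) $ i"
      by (simp add: qN matrix_vector_mult_diff_distrib)
    \<comment> \<open>As \<open>q = P(q)\<close>, the right-hand side is the remainder of the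
      first-order expansion of \<open>P\<close> around \<open>z\<close> at displacement
      \<open>e\<close>: \<open>e_j * e_k\<close> in a quadratic row, zero in a linear one.\<close>
    have eq: "(q - N) $ i - (B P z *v (q - N)) $ i = q $ i - system_eval P z $ i - (B P z *v e) $ i"
      unfolding B using d[of i] by (simp add: qN e_def)
    have Bq: "(B P q *v u) $ i \<le> u $ i" using B_q_complement_le by (simp add: u_def)
    show ?thesis
    proof (cases rule: row_cases[of i, case_names quad lin])
      case (quad j k)
      have qi: "q $ i = q $ j * q $ k" using quad(1)[of q] fixed_point by simp
      have val: "(q - N) $ i - (B P z *v (q - N)) $ i = e $ j * e $ k"
        unfolding eq by (simp add: quad(1,2) qi e_def algebra_simps)
      \<comment> \<open>Source of the factor one half: bounding either factor by
        \<open>r * u\<close> and adding the two estimates bounds twice the product by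
        \<open>r\<close> times row \<open>i\<close> of \<open>(B(q) - B(z)) u\<close>.\<close>
      have "e $ j * e $ k \<le> e $ j * (r * u $ k)" "e $ j * e $ k \<le> (r * u $ j) * e $ k"
        using e by (auto intro!: mult_left_mono mult_right_mono)
      then have "2 * (e $ j * e $ k) \<le> r * (e $ j * u $ k + u $ j * e $ k)" by (simp add: algebra_simps)
      also have "\<dots> = r * ((B P q *v u) $ i - (B P z *v u) $ i)" by (simp add: quad(1,2) e_def algebra_simps)
      also have "\<dots> \<le> r * (u $ i - (B P z *v u) $ i)" using Bq r by (intro mult_left_mono) auto
      finally show ?thesis unfolding val using e by simp
    next
      case (lin a c)
      have qi: "q $ i = (\<Sum>j\<in>UNIV. a j * q $ j) + c" using lin(1)[of q] fixed_point by simp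
      have val: "(q - N) $ i - (B P z *v (q - N)) $ i = 0"
        unfolding eq by (simp add: lin(1,2) qi e_def right_diff_distrib sum_subtractf)
      have "(B P z *v u) $ i \<le> u $ i" using Bq by (simp add: lin(2))
      then show ?thesis unfolding val using r by simp
    qed
  qed
  have "0 \<le> (q - N) $ i" for i
  proof (rule B_nonneg_solution[OF z(1,2)])
    show "(B P z *v (q - N)) $ i \<le> (q - N) $ i" for i using rem[of i] by simp
  qed
  then show "newton_step P z $ i \<le> q $ i" by (simp add: N_def)
  have "0 \<le> ((r / 2) *\<^sub>R u - (q - N)) $ i"
  proof (rule B_nonneg_solution[OF z(1,2)])
    show "(B P z *v ((r / 2) *\<^sub>R u - (q - N))) $ i \<le> ((r / 2) *\<^sub>R u - (q - N)) $ i" for i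
      using rem[of i]
      by (simp add: matrix_vector_mult_diff_distrib[of _ "(r / 2) *\<^sub>R u"] matrix_vector_mult_scaleR algebra_simps)
  qed
  then show "q $ i - newton_step P z $ i \<le> r / 2 * (1 - q $ i)" by (simp add: N_def u_def)
qed

text \<open>The hypotheses of \<open>newton_step_bounds\<close> are invariants. At the starting
  point zero the error is \<open>q\<close> itself, which fixes the condition on \<open>r\<close>,
  and \<open>P(0) \<ge> 0\<close> starts the invariant \<open>z \<le> P(z)\<close>.\<close>

lemma newton_iterate_bounds:
  assumes "\<And>i. q $ i \<le> r * (1 - q $ i)"
  shows "(\<forall>i. 0 \<le> newton_iterate P k $ i) \<and> (\<forall>i. newton_iterate P k $ i \<le> q $ i) \<and>
    (\<forall>i. newton_iterate P k $ i \<le> system_eval P (newton_iterate P k) $ i) \<and>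
    (\<forall>i. q $ i - newton_iterate P k $ i \<le> r / 2 ^ k * (1 - q $ i))"
proof (induction k)
  case 0
  have "0 \<le> system_eval P 0 $ i" for i
    by (cases rule: row_cases[of i]) simp_all
  then show ?case using assms q_pos by (simp add: newton_iterate_def less_imp_le)
next
  case (Suc k)
  let ?z = "newton_iterate P k"
  have step: "newton_iterate P (Suc k) = newton_step P ?z" by (simp add: newton_iterate_def)
  have z: "\<And>i. 0 \<le> ?z $ i" "\<And>i. ?z $ i \<le> q $ i" "\<And>i. ?z $ i \<le> system_eval P ?z $ i"
    "\<And>i. q $ i - ?z $ i \<le> r / 2 ^ k * (1 - q $ i)"
    using Suc by auto
  note b = newton_step_bounds[OF z]
  show ?case unfolding step
  proof (intro conjI allI)
    fix i
    show "0 \<le> newton_step P ?z $ i" using b(1)[of i] z(1)[of i] by linarith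
    show "q $ i - newton_step P ?z $ i \<le> r / 2 ^ Suc k * (1 - q $ i)"
      using b(4)[of i] by (simp add: mult.commute)
  qed (use b in auto)
qed

section \<open>Ratios between the entries of 1 - q\<close>

text \<open>In a quadratic row \<open>q_i\<close> is a product of numbers below one, hence at most
  each factor. In a linear row \<open>a_l * u_l\<close> is one term of a sum bounded by
  \<open>u_i\<close>, and the bit size bounds \<open>a_l\<close> from below.\<close>

lemma complement_le_successor:
  assumes "0 < Poly_Mapping.lookup (P i) m" and "0 < Poly_Mapping.lookup m l"
  shows "1 - q $ l \<le> 2 ^ coeff_bits P i * (1 - q $ i)"
proof (cases rule: row_cases[of i, case_names quad lin])
  case (quad j k)
  have qi: "q $ i = q $ j * q $ k" using quad(1)[of q] fixed_point by simp
  have "q $ j * q $ k \<le> q $ j * 1" "q $ j * q $ k \<le> 1 * q $ k"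
    using q_pos q_less_1 by (auto intro!: mult_left_mono mult_right_mono less_imp_le)
  then have "1 * (1 - q $ l) \<le> 1 - q $ i" using quad(3)[OF assms] qi by auto
  also have "\<dots> \<le> 2 ^ coeff_bits P i * (1 - q $ i)" using q_less_1[of i] by simp
  finally show ?thesis by simp
next
  case (lin a c)
  have qi: "q $ i = (\<Sum>j\<in>UNIV. a j * q $ j) + c" using lin(1)[of q] fixed_point by simp
  have "a l * (1 - q $ l) \<le> (\<Sum>j\<in>UNIV. a j * (1 - q $ j))"
    using lin(3) q_less_1 by (intro member_le_sum) (auto intro!: mult_nonneg_nonneg simp: less_imp_le)
  also have "\<dots> \<le> 1 - q $ i" using lin(5) qi by (simp add: right_diff_distrib sum_subtractf)
  finally have le: "a l * (1 - q $ l) \<le> 1 - q $ i" .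
  have "1 * (1 - q $ l) \<le> 2 ^ coeff_bits P i * a l * (1 - q $ l)"
    using lin(6)[OF assms] q_less_1[of l] by (intro mult_right_mono) auto
  also have "\<dots> \<le> 2 ^ coeff_bits P i * (1 - q $ i)" using le by simp
  finally show ?thesis by simp
qed

text \<open>Growing a set of good indices backwards along edges spends the bits of each row at most once.\<close>

lemma complement_ratio: "1 - q $ j \<le> 2 ^ encoding_size P * (1 - q $ i)"
proof -
  define good where "good T \<longleftrightarrow> j \<in> T \<and>
    (\<forall>i\<in>T. 1 - q $ j \<le> 2 ^ (\<Sum>l\<in>T. coeff_bits P l) * (1 - q $ i))" for T
  have "good {j}" using q_less_1[of j] by (simp add: good_def)
  then have "{T. good T} \<noteq> {}" by blast
  \<comment> \<open>A maximal good set takes the place of an explicit simple path to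
    \<open>j\<close>.\<close>
  then obtain T where T: "good T" and max: "\<And>T'. good T' \<Longrightarrow> T \<subseteq> T' \<Longrightarrow> T = T'"
    using finite_has_maximal[of "{T. good T}"] by auto
  have "T = UNIV"
  proof (rule ccontr)
    assume "T \<noteq> UNIV"
    then obtain i0 where "i0 \<in> - T" by auto
    moreover have "- T \<noteq> UNIV" using T by (auto simp: good_def)
    \<comment> \<open>The complement of \<open>T\<close> is nonempty and misses \<open>j\<close>, so
      it is not closed under edges: some edge enters \<open>T\<close> from outside.\<close>
    ultimately obtain i m l where i: "i \<notin> T" "l \<in> T"
      and edge: "0 < Poly_Mapping.lookup (P i) m" "0 < Poly_Mapping.lookup m l"
      using strongly_connected_closed_UNIV[OF sc, of i0 "- T"] by (metis ComplD ComplI)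
    let ?s = "\<Sum>l\<in>T. coeff_bits P l"
    have sum: "(\<Sum>l\<in>insert i T. coeff_bits P l) = ?s + coeff_bits P i" using i by simp
    have "good (insert i T)"
      unfolding good_def sum
    proof (intro conjI ballI)
      show "j \<in> insert i T" using T by (simp add: good_def)
      fix h assume "h \<in> insert i T"
      then consider "h = i" | "h \<in> T" by auto
      then show "1 - q $ j \<le> 2 ^ (?s + coeff_bits P i) * (1 - q $ h)"
      proof cases
        case 1
        have "1 - q $ j \<le> 2 ^ ?s * (1 - q $ l)" using T i by (simp add: good_def)
        also have "\<dots> \<le> 2 ^ ?s * (2 ^ coeff_bits P i * (1 - q $ i))"
          using complement_le_successor[OF edge] by simp
        finally show ?thesis using 1 by (simp add: power_add mult.assoc)
      next
        case 2
        then have "1 - q $ j \<le> 2 ^ ?s * (1 - q $ h)" using T by (simp add: good_def)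
        also have "\<dots> \<le> 2 ^ (?s + coeff_bits P i) * (1 - q $ h)"
          using q_less_1[of h] by (intro mult_right_mono) auto
        finally show ?thesis .
      qed
    qed
    then show False using max[of "insert i T"] i by auto
  qed
  then have "1 - q $ j \<le> 2 ^ (\<Sum>l\<in>UNIV. coeff_bits P l) * (1 - q $ i)" using T by (simp add: good_def)
  also have "\<dots> \<le> 2 ^ encoding_size P * (1 - q $ i)"
    using q_less_1[of i] sum_coeff_bits_le[of P] by (intro mult_right_mono power_increasing) auto
  finally show ?thesis .
qed

section \<open>Convergence from zero\<close>

text \<open>Invertibility is included because it makes every \<open>newton_step\<close> along the
  iteration a genuine Newton step.\<close>

lemma newton_iterate_converges:
  "invertible (mat 1 - B P (newton_iterate P k))"
  "infnorm (q - newton_iterate P (j + 2 * encoding_size P)) \<le> 1 / 2 ^ j"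
proof -
  \<comment> \<open>The initial ratio is \<open>r = 1 / s\<close>, because
    \<open>q \<le> 1 \<le> u / s\<close> in every entry.\<close>
  define s where "s = Min (range (\<lambda>i. 1 - q $ i))"
  have s_le: "s \<le> 1 - q $ i" for i unfolding s_def by (intro Min_le) auto
  have "s \<in> range (\<lambda>i. 1 - q $ i)" unfolding s_def by (intro Min_in) auto
  then obtain i0 where i0: "s = 1 - q $ i0" by auto
  have s: "0 < s" using q_less_1 by (simp add: i0)
  have "q $ i \<le> 1 / s * (1 - q $ i)" for i
  proof -
    have "1 \<le> (1 - q $ i) / s" using s s_le[of i] by simp
    with q_less_1[of i] show ?thesis by simp
  qed
  note bounds = newton_iterate_bounds[OF this]
  show "invertible (mat 1 - B P (newton_iterate P k))"
    using bounds[of k] by (intro invertible_newton_matrix) auto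
  let ?M = "encoding_size P"
  let ?x = "newton_iterate P (j + 2 * ?M)"
  have "\<bar>(q - ?x) $ i\<bar> \<le> 1 / 2 ^ j" for i
  proof -
    \<comment> \<open>\<open>s\<close> is attained at \<open>i0\<close>, so this is a ratio of two
      entries of \<open>u\<close>. Weakening it to \<open>2 ^ (2 * ?M)\<close> matches the shift of
      the iteration index and leaves exactly \<open>1 / 2 ^ j\<close>.\<close>
    have "1 / s * (1 - q $ i) \<le> 2 ^ ?M"
      using complement_ratio[of i i0] s by (simp add: i0[symmetric] pos_divide_le_eq)
    also have "\<dots> \<le> 2 ^ (2 * ?M)" by simp
    finally have "1 / s * (1 - q $ i) / 2 ^ (j + 2 * ?M) \<le> 2 ^ (2 * ?M) / 2 ^ (j + 2 * ?M)"
      by (intro divide_right_mono) auto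
    also have "\<dots> = 1 / 2 ^ j" by (simp add: power_add)
    finally have "1 / s / 2 ^ (j + 2 * ?M) * (1 - q $ i) \<le> 1 / 2 ^ j" by simp
    moreover have "q $ i - ?x $ i \<le> 1 / s / 2 ^ (j + 2 * ?M) * (1 - q $ i)" and "?x $ i \<le> q $ i"
      using bounds[of "j + 2 * ?M"] by blast+
    ultimately show ?thesis by simp
  qed
  then show "infnorm (q - ?x) \<le> 1 / 2 ^ j"
    unfolding infnorm_Max by (auto simp: Basis_vec_def inner_axis)
qed

end

theorem theorem3p11:
  fixes P :: "'n::finite system" and q :: "real ^ 'n"
  assumes "is_pps P"
    and "simple_normal_form P"
    and "strongly_connected (with_proj (dependency_graph P))"
    and "is_lfp P q"
    and "\<And>i. 0 < q $ i" and "\<And>i. q $ i < 1"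
  shows "(\<forall>k. invertible (mat 1 - B P (newton_iterate P k))) \<and>
    (\<forall>j. infnorm (q - newton_iterate P (j + 2 * encoding_size P)) \<le> 1 / 2 ^ j)"
proof -
  interpret snf_pps P q using assms by unfold_locales
  show ?thesis using newton_iterate_converges by blast
qed

end
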